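(* Let $M$ be a $G$-graded $R$-module, let $N,N'\leq_G M$ and $I\lhd_G R$. Then: (1) $Z.soc_G(Ann_M(I))=Z.soc_G(Ann_M(Gr(I)))=soc_G(Ann_M(I))=soc_G(Ann_M(Gr(I)))$. (2) $Z.soc_G(N)=Z.soc_G(Ann_M(Ann_R(N)))=Z.soc_G(Ann_M(Gr(Ann_R(N))))=soc_G(Ann_M(Ann_R(N)))=soc_G(Ann_M(Gr(Ann_R(N))))$. (3) $soc_G(N)\subseteq Z.soc_G(N)$. Moreover, if $M$ is a comultiplication $G$-graded $R$-module, then equality holds. (4) If $V_G^s(N)\subseteq V_G^s(N')$, then $Z.soc_G(N)\subseteq Z.soc_G(N')$. (5) $V_G^s(N)=V_G^s(N')$ if and only if $Z.soc_G(N)=Z.soc_G(N')$.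
   Context: $G$ is an abelian group with identity $e$; all rings are commutative with unity $1$. A $G$-graded ring is a ring $R=\bigoplus_{g\in G}R_g$ with additive subgroups $R_g$ satisfying $R_gR_h\subseteq R_{gh}$; $h(R)=\bigcup_{g}R_g$. An ideal $I$ is graded ($I\lhd_G R$) if $I=\bigoplus_g (I\cap R_g)$. The graded radical $Gr(I)$ of $I\lhd_G R$ is the set of all $a=\sum_g a_g\in R$ (with $a_g\in R_g$) such that for each $g$ there is $n_g>0$ with $a_g^{n_g}\in I$. A $G$-graded $R$-module is an $R$-module $M=\bigoplus_{g\in G}M_g$ with $R_gM_h\subseteq M_{gh}$; a submodule $N$ is graded ($N\leq_G M$) if $N=\bigoplus_g(N\cap M_g)$. $Ann_R(N)=\{r\in R: rN=0\}$ and $Ann_M(I)=\{m\in M: Im=0\}$. A non-zero graded submodule $S$ of $M$ is graded second if for every $r\in h(R)$, $rS=S$ or $rS=0$; $\mathrm{Spec}_G^s(M)$ is the set of all graded second submodules of $M$. For $N\leq_G M$, $V_G^s(N)=\{S\in \mathrm{Spec}_G^s(M): Ann_R(N)\subseteq Ann_R(S)\}$. The graded second socle $soc_G(N)$ is the sum of all graded second submodules of $M$ contained in $N$ ($\{0\}$ if there are none). The graded Zariski socle $Z.soc_G(N)$ is the sum of all members of $V_G^s(N)$ ($\{0\}$ if $V_G^s(N)=\emptyset$). $M$ is a comultiplication graded $R$-module if every $N\leq_G M$ has the form $N=Ann_M(I)$ for some $I\lhd_G R$. *)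

theory Defs
  imports "HOL-Algebra.Module" "HOL-Algebra.Ideal" "HOL-Library.FuncSet"
begin

section \<open>Internal direct sums and sums of families of submodules\<close>

text \<open>The families \<open>(c\<^sub>j)\<close> with \<open>c\<^sub>j \<in> A\<^sub>j\<close>, almost all zero, that sum up to \<open>x\<close>. The sum is
  restricted to the support because \<^const>\<open>finsum\<close> is \<open>\<zero>\<close> by convention on infinite index
  sets, and \<open>c\<close> is extensional so that uniqueness of the family is equality of functions.\<close>

definition decompositions ::
    "('a, 'm) ring_scheme \<Rightarrow> 'j set \<Rightarrow> ('j \<Rightarrow> 'a set) \<Rightarrow> 'a \<Rightarrow> ('j \<Rightarrow> 'a) set" where
  "decompositions X J A x =
     {c \<in> (\<Pi>\<^sub>E j\<in>J. A j). finite {j \<in> J. c j \<noteq> \<zero>\<^bsub>X\<^esub>} \<and> finsum X c {j \<in> J. c j \<noteq> \<zero>\<^bsub>X\<^esub>} = x}"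

text \<open>\<open>B\<close> is the internal direct sum of the additive subgroups \<open>A\<^sub>j\<close> of \<open>X\<close>.\<close>

definition is_direct_sum ::
    "('a, 'm) ring_scheme \<Rightarrow> 'j set \<Rightarrow> ('j \<Rightarrow> 'a set) \<Rightarrow> 'a set \<Rightarrow> bool" where
  "is_direct_sum X J A B \<longleftrightarrow>
     (\<forall>j\<in>J. additive_subgroup (A j) X) \<and>
     B = {x. decompositions X J A x \<noteq> {}} \<and>
     (\<forall>x\<in>B. \<exists>!c. c \<in> decompositions X J A x)"

text \<open>The empty family has sum \<open>{\<zero>}\<close>.\<close>

definition submodule_sum :: "('r, 'a, 'm) module_scheme \<Rightarrow> 'a set set \<Rightarrow> 'a set" where
  "submodule_sum M \<S> = {finsum M f F | F f. finite F \<and> F \<subseteq> \<S> \<and> f \<in> (\<Pi> S\<in>F. S)}"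


section \<open>Graded rings and modules\<close>

locale graded_ring = G: comm_group G + R: cring R
  for G :: "('g, 'k) monoid_scheme" (structure) and R :: "('r, 'l) ring_scheme" (structure) +
  fixes Rg :: "'g \<Rightarrow> 'r set"
  assumes ring_direct_sum: "is_direct_sum R (carrier G) Rg (carrier R)"
    and ring_mult_graded:
      "\<lbrakk>g \<in> carrier G; h \<in> carrier G; a \<in> Rg g; b \<in> Rg h\<rbrakk> \<Longrightarrow> a \<otimes>\<^bsub>R\<^esub> b \<in> Rg (g \<otimes>\<^bsub>G\<^esub> h)"

locale graded_module = graded_ring G R Rg + module R M
  for G :: "('g, 'k) monoid_scheme" (structure) and R :: "('r, 'l) ring_scheme" (structure)
    and Rg :: "'g \<Rightarrow> 'r set" and M :: "('r, 'a, 'm) module_scheme" (structure) +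
  fixes Mg :: "'g \<Rightarrow> 'a set"
  assumes module_direct_sum: "is_direct_sum M (carrier G) Mg (carrier M)"
    and smult_graded:
      "\<lbrakk>g \<in> carrier G; h \<in> carrier G; a \<in> Rg g; x \<in> Mg h\<rbrakk> \<Longrightarrow> a \<odot>\<^bsub>M\<^esub> x \<in> Mg (g \<otimes>\<^bsub>G\<^esub> h)"

definition homogeneous :: "('g, 'k) monoid_scheme \<Rightarrow> ('g \<Rightarrow> 'r set) \<Rightarrow> 'r set" where
  "homogeneous G Rg = (\<Union>g\<in>carrier G. Rg g)"

definition graded_ideal ::
    "('g, 'k) monoid_scheme \<Rightarrow> ('r, 'l) ring_scheme \<Rightarrow> ('g \<Rightarrow> 'r set) \<Rightarrow> 'r set \<Rightarrow> bool" where
  "graded_ideal G R Rg I \<longleftrightarrow> ideal I R \<and> is_direct_sum R (carrier G) (\<lambda>g. I \<inter> Rg g) I"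

definition graded_submodule ::
    "('g, 'k) monoid_scheme \<Rightarrow> ('r, 'l) ring_scheme \<Rightarrow> ('r, 'a, 'm) module_scheme \<Rightarrow>
     ('g \<Rightarrow> 'a set) \<Rightarrow> 'a set \<Rightarrow> bool" where
  "graded_submodule G R M Mg N \<longleftrightarrow>
     submodule N R M \<and> is_direct_sum M (carrier G) (\<lambda>g. N \<inter> Mg g) N"

definition graded_radical ::
    "('g, 'k) monoid_scheme \<Rightarrow> ('r, 'l) ring_scheme \<Rightarrow> ('g \<Rightarrow> 'r set) \<Rightarrow> 'r set \<Rightarrow> 'r set" where
  "graded_radical G R Rg I =
     {a \<in> carrier R. \<exists>c \<in> decompositions R (carrier G) Rg a.
        \<forall>g\<in>carrier G. \<exists>n::nat. n > 0 \<and> c g [^]\<^bsub>R\<^esub> n \<in> I}"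

definition ann_ring ::
    "('r, 'l) ring_scheme \<Rightarrow> ('r, 'a, 'm) module_scheme \<Rightarrow> 'a set \<Rightarrow> 'r set" where
  "ann_ring R M N = {r \<in> carrier R. \<forall>x\<in>N. r \<odot>\<^bsub>M\<^esub> x = \<zero>\<^bsub>M\<^esub>}"

definition ann_module :: "('r, 'a, 'm) module_scheme \<Rightarrow> 'r set \<Rightarrow> 'a set" where
  "ann_module M I = {x \<in> carrier M. \<forall>r\<in>I. r \<odot>\<^bsub>M\<^esub> x = \<zero>\<^bsub>M\<^esub>}"

definition comultiplication_graded_module ::
    "('g, 'k) monoid_scheme \<Rightarrow> ('r, 'l) ring_scheme \<Rightarrow> ('g \<Rightarrow> 'r set) \<Rightarrow>
     ('r, 'a, 'm) module_scheme \<Rightarrow> ('g \<Rightarrow> 'a set) \<Rightarrow> bool" where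
  "comultiplication_graded_module G R Rg M Mg \<longleftrightarrow>
     (\<forall>N. graded_submodule G R M Mg N \<longrightarrow> (\<exists>I. graded_ideal G R Rg I \<and> N = ann_module M I))"


section \<open>Graded second submodules and socles\<close>

definition graded_second ::
    "('g, 'k) monoid_scheme \<Rightarrow> ('r, 'l) ring_scheme \<Rightarrow> ('g \<Rightarrow> 'r set) \<Rightarrow>
     ('r, 'a, 'm) module_scheme \<Rightarrow> ('g \<Rightarrow> 'a set) \<Rightarrow> 'a set \<Rightarrow> bool" where
  "graded_second G R Rg M Mg S \<longleftrightarrow>
     graded_submodule G R M Mg S \<and> S \<noteq> {\<zero>\<^bsub>M\<^esub>} \<and>
     (\<forall>r\<in>homogeneous G Rg. (\<lambda>x. r \<odot>\<^bsub>M\<^esub> x) ` S = S \<or> (\<lambda>x. r \<odot>\<^bsub>M\<^esub> x) ` S = {\<zero>\<^bsub>M\<^esub>})"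

definition graded_second_spectrum ::
    "('g, 'k) monoid_scheme \<Rightarrow> ('r, 'l) ring_scheme \<Rightarrow> ('g \<Rightarrow> 'r set) \<Rightarrow>
     ('r, 'a, 'm) module_scheme \<Rightarrow> ('g \<Rightarrow> 'a set) \<Rightarrow> 'a set set" where
  "graded_second_spectrum G R Rg M Mg = {S. graded_second G R Rg M Mg S}"

definition second_variety ::
    "('g, 'k) monoid_scheme \<Rightarrow> ('r, 'l) ring_scheme \<Rightarrow> ('g \<Rightarrow> 'r set) \<Rightarrow>
     ('r, 'a, 'm) module_scheme \<Rightarrow> ('g \<Rightarrow> 'a set) \<Rightarrow> 'a set \<Rightarrow> 'a set set" where
  "second_variety G R Rg M Mg N =
     {S \<in> graded_second_spectrum G R Rg M Mg. ann_ring R M N \<subseteq> ann_ring R M S}"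

definition graded_socle ::
    "('g, 'k) monoid_scheme \<Rightarrow> ('r, 'l) ring_scheme \<Rightarrow> ('g \<Rightarrow> 'r set) \<Rightarrow>
     ('r, 'a, 'm) module_scheme \<Rightarrow> ('g \<Rightarrow> 'a set) \<Rightarrow> 'a set \<Rightarrow> 'a set" where
  "graded_socle G R Rg M Mg N =
     submodule_sum M {S \<in> graded_second_spectrum G R Rg M Mg. S \<subseteq> N}"

definition graded_zariski_socle ::
    "('g, 'k) monoid_scheme \<Rightarrow> ('r, 'l) ring_scheme \<Rightarrow> ('g \<Rightarrow> 'r set) \<Rightarrow>
     ('r, 'a, 'm) module_scheme \<Rightarrow> ('g \<Rightarrow> 'a set) \<Rightarrow> 'a set \<Rightarrow> 'a set" where
  "graded_zariski_socle G R Rg M Mg N = submodule_sum M (second_variety G R Rg M Mg N)"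

end

theory Submission
  imports Defs
begin

text \<open>The Galois connection \<open>K \<subseteq> Ann\<^sub>R(S) \<longleftrightarrow> S \<subseteq> Ann\<^sub>M(K)\<close> shows that the second submodules in the
  variety of \<open>Ann\<^sub>M(K)\<close> are exactly those contained in \<open>Ann\<^sub>M(K)\<close>, so the two socles of
  \<open>Ann\<^sub>M(K)\<close> agree. A homogeneous element with a power killing a second submodule \<open>S\<close> kills \<open>S\<close>,
  hence \<open>I\<close> and \<open>Gr(I)\<close> are contained in the same annihilators \<open>Ann\<^sub>R(S)\<close>; to apply this to
  \<open>Ann\<^sub>R(N)\<close> one needs that it contains the homogeneous components of its elements. Finally, the
  variety of \<open>N\<close> is recovered from its Zariski socle because \<open>Ann\<^sub>R(N)\<close> kills that socle.\<close>

lemma submodule_sum_mono: "\<S> \<subseteq> \<T> \<Longrightarrow> submodule_sum M \<S> \<subseteq> submodule_sum M \<T>"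
  unfolding submodule_sum_def by blast

section \<open>Annihilators and sums of submodules, without grading\<close>

context module
begin

lemma finsum_smult_rdistr:
  assumes "finite A" "x \<in> carrier M" "f \<in> A \<rightarrow> carrier R"
  shows "finsum R f A \<odot>\<^bsub>M\<^esub> x = (\<Oplus>\<^bsub>M\<^esub>i\<in>A. f i \<odot>\<^bsub>M\<^esub> x)"
  using assms by (induct set: finite) (simp_all add: Pi_def smult_l_distr)

lemma subset_submodule_sum:
  assumes "S \<in> \<S>" "S \<subseteq> carrier M"
  shows "S \<subseteq> submodule_sum M \<S>"
proof
  fix x assume x: "x \<in> S"
  have "finsum M (\<lambda>_. x) {S} = x"
    using x assms by (simp add: subset_iff)
  then show "x \<in> submodule_sum M \<S>"
    unfolding submodule_sum_def using x assms
    by (auto intro!: exI[of _ "{S}"] exI[of _ "\<lambda>_. x"])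
qed

lemma subset_ann_ring_iff:
  assumes "K \<subseteq> carrier R" "S \<subseteq> carrier M"
  shows "K \<subseteq> ann_ring R M S \<longleftrightarrow> S \<subseteq> ann_module M K"
  using assms unfolding ann_ring_def ann_module_def by blast

lemma ann_ring_subset: "ann_ring R M S \<subseteq> carrier R"
  unfolding ann_ring_def by blast

text \<open>A triangle identity of the Galois connection. It makes \<open>N\<close> and its double
  annihilator indistinguishable to \<open>second_variety\<close>.\<close>

lemma ann_ring_ann_module_ann_ring:
  assumes "S \<subseteq> carrier M"
  shows "ann_ring R M (ann_module M (ann_ring R M S)) = ann_ring R M S"
  using assms unfolding ann_ring_def ann_module_def by blast

text \<open>From left to right, \<open>K\<close> kills \<open>ann_module M K\<close>, so it lies in
  the left-hand annihilator and hence kills \<open>S\<close>. From right to left,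
  \<open>ann_ring\<close> reverses inclusions.\<close>

lemma ann_ring_subset_ann_ring_ann_module_iff:
  assumes "K \<subseteq> carrier R" "S \<subseteq> carrier M"
  shows "ann_ring R M (ann_module M K) \<subseteq> ann_ring R M S \<longleftrightarrow> S \<subseteq> ann_module M K"
  using assms unfolding ann_ring_def ann_module_def by blast

lemma ann_ring_kills_submodule_sum:
  assumes "\<And>S. S \<in> \<S> \<Longrightarrow> S \<subseteq> carrier M \<and> r \<in> ann_ring R M S"
    and r: "r \<in> carrier R"
  shows "r \<in> ann_ring R M (submodule_sum M \<S>)"
proof -
  have "r \<odot>\<^bsub>M\<^esub> finsum M f F = \<zero>\<^bsub>M\<^esub>"
    if F: "finite F" "F \<subseteq> \<S>" and f: "f \<in> (\<Pi> S\<in>F. S)" for F f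
  proof -
    have fF: "f S \<in> carrier M" "r \<odot>\<^bsub>M\<^esub> f S = \<zero>\<^bsub>M\<^esub>" if "S \<in> F" for S
      using assms(1)[of S] that F f by (auto simp: ann_ring_def Pi_def)
    then have "r \<odot>\<^bsub>M\<^esub> finsum M f F = (\<Oplus>\<^bsub>M\<^esub>S\<in>F. r \<odot>\<^bsub>M\<^esub> f S)"
      using F r by (intro finsum_smult_ldistr) auto
    also have "\<dots> = \<zero>\<^bsub>M\<^esub>"
      using fF by (intro M.add.finprod_one_eqI) auto
    finally show ?thesis .
  qed
  then show ?thesis
    using r unfolding ann_ring_def submodule_sum_def by auto
qed

text \<open>The action distributes over the finite sum of the components, so an element kills
  \<open>S\<close> as soon as all its components do.\<close>

lemma ann_ring_decompositions:
  assumes "S \<subseteq> carrier M" "c \<in> decompositions R J A r" "\<And>j. j \<in> J \<Longrightarrow> c j \<in> ann_ring R M S"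
  shows "r \<in> ann_ring R M S"
proof -
  let ?T = "{j \<in> J. c j \<noteq> \<zero>\<^bsub>R\<^esub>}"
  have fin: "finite ?T" and r: "finsum R c ?T = r"
    using assms(2) by (auto simp: decompositions_def)
  have c: "c \<in> ?T \<rightarrow> carrier R"
    using assms(3) by (auto simp: ann_ring_def)
  have "r \<odot>\<^bsub>M\<^esub> x = \<zero>\<^bsub>M\<^esub>" if "x \<in> S" for x
  proof -
    have "r \<odot>\<^bsub>M\<^esub> x = (\<Oplus>\<^bsub>M\<^esub>j\<in>?T. c j \<odot>\<^bsub>M\<^esub> x)"
      using finsum_smult_rdistr[OF fin _ c, of x] that assms(1) r by auto
    also have "\<dots> = \<zero>\<^bsub>M\<^esub>"
      using that assms(3) by (intro M.add.finprod_one_eqI) (auto simp: ann_ring_def)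
    finally show ?thesis .
  qed
  moreover have "r \<in> carrier R"
    using r R.finsum_closed[OF c] by simp
  ultimately show ?thesis by (simp add: ann_ring_def)
qed

text \<open>Iterating a surjection of \<open>S\<close> onto itself stays surjective; hence no power
  of such an \<open>r\<close> can kill a nonzero \<open>S\<close>.\<close>

lemma smult_pow_image_eq:
  assumes "r \<in> carrier R" "S \<subseteq> carrier M" "(\<lambda>x. r \<odot>\<^bsub>M\<^esub> x) ` S = S"
  shows "(\<lambda>x. (r [^]\<^bsub>R\<^esub> (n::nat)) \<odot>\<^bsub>M\<^esub> x) ` S = S"
proof (induct n)
  case 0
  then show ?case using assms(2) by (force simp: subset_iff)
next
  case (Suc n)
  have "(\<lambda>x. (r [^]\<^bsub>R\<^esub> Suc n) \<odot>\<^bsub>M\<^esub> x) ` S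
      = (\<lambda>x. (r [^]\<^bsub>R\<^esub> n) \<odot>\<^bsub>M\<^esub> x) ` (\<lambda>x. r \<odot>\<^bsub>M\<^esub> x) ` S"
    using assms(1,2) unfolding image_image
    by (intro image_cong) (auto simp: smult_assoc1 subset_iff)
  then show ?case using Suc assms(3) by simp
qed

end

section \<open>Homogeneous components of the elements of an annihilator\<close>

context graded_module
begin

lemma Rg_subset: "g \<in> carrier G \<Longrightarrow> Rg g \<subseteq> carrier R"
  using ring_direct_sum additive_subgroup.a_subset unfolding is_direct_sum_def by metis

lemma Mg_additive_subgroup: "g \<in> carrier G \<Longrightarrow> additive_subgroup (Mg g) M"
  using module_direct_sum unfolding is_direct_sum_def by metis

lemma Mg_subset: "g \<in> carrier G \<Longrightarrow> Mg g \<subseteq> carrier M"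
  using Mg_additive_subgroup additive_subgroup.a_subset by metis

lemma graded_submodule_subset: "graded_submodule G R M Mg N \<Longrightarrow> N \<subseteq> carrier M"
  unfolding graded_submodule_def using submoduleE(1) by blast

lemma graded_second_subset: "S \<in> graded_second_spectrum G R Rg M Mg \<Longrightarrow> S \<subseteq> carrier M"
  unfolding graded_second_spectrum_def graded_second_def using graded_submodule_subset by blast

lemma zero_decomposition_unique:
  assumes e: "e \<in> (\<Pi>\<^sub>E k\<in>carrier G. Mg k)"
    and fin: "finite {k \<in> carrier G. e k \<noteq> \<zero>\<^bsub>M\<^esub>}"
    and sum: "finsum M e {k \<in> carrier G. e k \<noteq> \<zero>\<^bsub>M\<^esub>} = \<zero>\<^bsub>M\<^esub>"
    and k: "k \<in> carrier G"
  shows "e k = \<zero>\<^bsub>M\<^esub>"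
proof -
  \<comment> \<open>The zero family, restricted so as to be extensional: it is a second
    decomposition of zero, with empty support, to which uniqueness compares
    \<open>e\<close>.\<close>
  let ?z = "restrict (\<lambda>_. \<zero>\<^bsub>M\<^esub>) (carrier G)"
  have "{k \<in> carrier G. ?z k \<noteq> \<zero>\<^bsub>M\<^esub>} = {}" by auto
  then have "?z \<in> decompositions M (carrier G) Mg \<zero>\<^bsub>M\<^esub>"
    unfolding decompositions_def
    using additive_subgroup.zero_closed[OF Mg_additive_subgroup] by auto
  moreover have "e \<in> decompositions M (carrier G) Mg \<zero>\<^bsub>M\<^esub>"
    using e fin sum unfolding decompositions_def by simp
  ultimately have "e = ?z"
    using module_direct_sum M.zero_closed unfolding is_direct_sum_def by blast
  then show ?thesis using k by simp
qed

text \<open>The products \<open>c g \<odot> y\<close> add up to \<open>r \<odot> y\<close> and lie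
  in the degrees \<open>g \<otimes> h\<close>, which are pairwise distinct because \<open>G\<close>
  is a group. A zero sum of elements of distinct degrees has only zero terms.\<close>

lemma component_smult_homogeneous_eq_zero:
  assumes c: "c \<in> decompositions R (carrier G) Rg r"
    and h: "h \<in> carrier G" and y: "y \<in> Mg h" and ry: "r \<odot>\<^bsub>M\<^esub> y = \<zero>\<^bsub>M\<^esub>"
    and g: "g \<in> carrier G"
  shows "c g \<odot>\<^bsub>M\<^esub> y = \<zero>\<^bsub>M\<^esub>"
proof -
  let ?T = "{g \<in> carrier G. c g \<noteq> \<zero>\<^bsub>R\<^esub>}"
  let ?sh = "\<lambda>g. g \<otimes>\<^bsub>G\<^esub> h"
  \<comment> \<open>The decomposition of \<open>r \<odot> y\<close>, indexed by degree in
    \<open>M\<close>: the part of degree \<open>k\<close> comes from the component of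
    \<open>r\<close> of degree \<open>k\<close> times the inverse of \<open>h\<close>.\<close>
  define e where "e = restrict (\<lambda>k. c (k \<otimes>\<^bsub>G\<^esub> inv\<^bsub>G\<^esub> h) \<odot>\<^bsub>M\<^esub> y) (carrier G)"
  have cRg: "c g \<in> Rg g" if "g \<in> carrier G" for g
    using c that unfolding decompositions_def by (auto simp: PiE_def Pi_def)
  then have cR: "c g \<in> carrier R" if "g \<in> carrier G" for g
    using Rg_subset that by blast
  have fin: "finite ?T" and r: "finsum R c ?T = r"
    using c by (auto simp: decompositions_def)
  have yM: "y \<in> carrier M" using y h Mg_subset by blast
  have shift: "k \<otimes>\<^bsub>G\<^esub> inv\<^bsub>G\<^esub> h \<otimes>\<^bsub>G\<^esub> h = k" if "k \<in> carrier G" for k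
    using that h by (simp add: G.m_assoc)
  have eM: "e k \<in> Mg k" if "k \<in> carrier G" for k
    using smult_graded[OF _ h cRg y, of "k \<otimes>\<^bsub>G\<^esub> inv\<^bsub>G\<^esub> h"] that h shift unfolding e_def by simp
  have e_sh: "e (?sh g) = c g \<odot>\<^bsub>M\<^esub> y" if "g \<in> carrier G" for g
    using that h by (simp add: e_def G.m_assoc)
  let ?E = "{k \<in> carrier G. e k \<noteq> \<zero>\<^bsub>M\<^esub>}"
  \<comment> \<open>Only an inclusion is claimed, since a nonzero component of \<open>r\<close> may
    still kill \<open>y\<close>. The extra summands are zero, so the sum over the support of
    \<open>e\<close> can be taken over the shifted support of \<open>c\<close>.\<close>
  have sub: "?E \<subseteq> ?sh ` ?T"
  proof
    fix k assume k: "k \<in> ?E"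
    then have "c (k \<otimes>\<^bsub>G\<^esub> inv\<^bsub>G\<^esub> h) \<noteq> \<zero>\<^bsub>R\<^esub>" using yM by (auto simp: e_def)
    then show "k \<in> ?sh ` ?T"
      using k h shift by (intro image_eqI[of _ _ "k \<otimes>\<^bsub>G\<^esub> inv\<^bsub>G\<^esub> h"]) auto
  qed
  have imG: "?sh ` ?T \<subseteq> carrier G" using h by auto
  have e_carrier: "e \<in> ?sh ` ?T \<rightarrow> carrier M"
    using eM imG Mg_subset by blast
  have "finsum M e ?E = finsum M e (?sh ` ?T)"
    using fin sub imG e_carrier by (intro M.add.finprod_mono_neutral_cong_left) auto
  also have "\<dots> = (\<Oplus>\<^bsub>M\<^esub>g\<in>?T. e (?sh g))"
    using h by (intro M.finsum_reindex e_carrier) (auto simp: inj_on_def)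
  also have "\<dots> = (\<Oplus>\<^bsub>M\<^esub>g\<in>?T. c g \<odot>\<^bsub>M\<^esub> y)"
    using e_sh cR yM by (intro M.finsum_cong') auto
  also have "\<dots> = r \<odot>\<^bsub>M\<^esub> y"
    using finsum_smult_rdistr[OF fin yM, of c] cR r by auto
  finally have "finsum M e ?E = \<zero>\<^bsub>M\<^esub>" using ry by simp
  moreover have "e \<in> (\<Pi>\<^sub>E k\<in>carrier G. Mg k)"
    using eM by (auto simp: e_def)
  moreover have "finite ?E" using finite_subset[OF sub] fin by simp
  ultimately have "e (?sh g) = \<zero>\<^bsub>M\<^esub>"
    using zero_decomposition_unique[of e "?sh g"] g h by simp
  then show ?thesis using e_sh g by simp
qed

text \<open>Homogeneous elements of \<open>N\<close> are handled by the preceding lemma. As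
  \<open>N\<close> is graded, each of its elements is a sum of homogeneous elements that lie in
  \<open>N\<close> again and are therefore killed by \<open>r\<close>.\<close>

lemma component_in_ann_ring:
  assumes N: "graded_submodule G R M Mg N" and r: "r \<in> ann_ring R M N"
    and c: "c \<in> decompositions R (carrier G) Rg r" and g: "g \<in> carrier G"
  shows "c g \<in> ann_ring R M N"
proof -
  have cR: "c g \<in> carrier R"
    using c g Rg_subset unfolding decompositions_def by (auto simp: PiE_def Pi_def)
  have "c g \<odot>\<^bsub>M\<^esub> x = \<zero>\<^bsub>M\<^esub>" if x: "x \<in> N" for x
  proof -
    obtain d where d: "d \<in> decompositions M (carrier G) (\<lambda>h. N \<inter> Mg h) x"
      using N x unfolding graded_submodule_def is_direct_sum_def by blast
    let ?T = "{h \<in> carrier G. d h \<noteq> \<zero>\<^bsub>M\<^esub>}"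
    have dh: "d h \<in> N" "d h \<in> Mg h" if "h \<in> carrier G" for h
      using d that unfolding decompositions_def by (auto simp: PiE_def Pi_def)
    have fin: "finite ?T" and dx: "finsum M d ?T = x"
      using d by (auto simp: decompositions_def)
    have "c g \<odot>\<^bsub>M\<^esub> finsum M d ?T = (\<Oplus>\<^bsub>M\<^esub>h\<in>?T. c g \<odot>\<^bsub>M\<^esub> d h)"
      using fin cR dh(1) graded_submodule_subset[OF N] by (intro finsum_smult_ldistr) auto
    also have "\<dots> = \<zero>\<^bsub>M\<^esub>"
    proof (rule M.add.finprod_one_eqI)
      fix h assume "h \<in> ?T"
      then have h: "h \<in> carrier G" by simp
      have "r \<odot>\<^bsub>M\<^esub> d h = \<zero>\<^bsub>M\<^esub>" using r dh(1)[OF h] by (simp add: ann_ring_def)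
      then show "c g \<odot>\<^bsub>M\<^esub> d h = \<zero>\<^bsub>M\<^esub>"
        using component_smult_homogeneous_eq_zero[OF c h dh(2)[OF h] _ g] by simp
    qed
    finally show ?thesis using dx by simp
  qed
  then show ?thesis using cR by (simp add: ann_ring_def)
qed

section \<open>The graded radical and annihilators of second submodules\<close>

lemma subset_graded_radical:
  assumes "K \<subseteq> carrier R"
    and "\<And>r. r \<in> K \<Longrightarrow> \<exists>c \<in> decompositions R (carrier G) Rg r. \<forall>g\<in>carrier G. c g \<in> K"
  shows "K \<subseteq> graded_radical G R Rg K"
proof
  fix r assume r: "r \<in> K"
  then obtain c where c: "c \<in> decompositions R (carrier G) Rg r" "\<forall>g\<in>carrier G. c g \<in> K"
    using assms(2) by blast
  \<comment> \<open>Exponent 1 witnesses membership in the radical.\<close>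
  have "c g [^]\<^bsub>R\<^esub> (1::nat) \<in> K" if "g \<in> carrier G" for g
    using c(2) assms(1) that by (simp add: subset_iff)
  then show "r \<in> graded_radical G R Rg K"
    unfolding graded_radical_def using r assms(1) c(1) zero_less_one by blast
qed

lemma graded_ideal_subset_graded_radical:
  assumes I: "graded_ideal G R Rg I"
  shows "I \<subseteq> graded_radical G R Rg I"
proof (rule subset_graded_radical)
  show "I \<subseteq> carrier R"
    using I additive_subgroup.a_subset ideal.axioms(1) unfolding graded_ideal_def by metis
  fix r assume "r \<in> I"
  then obtain c where c: "c \<in> decompositions R (carrier G) (\<lambda>g. I \<inter> Rg g) r"
    using I unfolding graded_ideal_def is_direct_sum_def by blast
  then have "c \<in> decompositions R (carrier G) Rg r" "\<forall>g\<in>carrier G. c g \<in> I"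
    unfolding decompositions_def by (auto simp: PiE_def Pi_def)
  then show "\<exists>c \<in> decompositions R (carrier G) Rg r. \<forall>g\<in>carrier G. c g \<in> I" by blast
qed

text \<open>Closure under homogeneous components suffices here, so \<open>ann_ring R M N\<close> is
  never shown to be a graded ideal.\<close>

lemma ann_ring_subset_graded_radical:
  assumes N: "graded_submodule G R M Mg N"
  shows "ann_ring R M N \<subseteq> graded_radical G R Rg (ann_ring R M N)"
proof (rule subset_graded_radical[OF ann_ring_subset])
  fix r assume r: "r \<in> ann_ring R M N"
  then obtain c where "c \<in> decompositions R (carrier G) Rg r"
    using ring_direct_sum unfolding is_direct_sum_def ann_ring_def by blast
  then show "\<exists>c \<in> decompositions R (carrier G) Rg r. \<forall>g\<in>carrier G. c g \<in> ann_ring R M N"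
    using component_in_ann_ring[OF N r] by blast
qed

text \<open>Multiplication by a homogeneous \<open>r\<close> is either onto \<open>S\<close> or zero
  on \<open>S\<close>. Being onto would pass to the power, which annihilates the nonzero
  \<open>S\<close>.\<close>

lemma homogeneous_pow_in_ann_ring_second:
  assumes S: "S \<in> graded_second_spectrum G R Rg M Mg"
    and r: "g \<in> carrier G" "r \<in> Rg g" and n: "r [^]\<^bsub>R\<^esub> (n::nat) \<in> ann_ring R M S"
  shows "r \<in> ann_ring R M S"
proof -
  have rR: "r \<in> carrier R" using r Rg_subset by blast
  have SM: "S \<subseteq> carrier M" using graded_second_subset[OF S] .
  have S0: "S \<noteq> {\<zero>\<^bsub>M\<^esub>}" and sec: "(\<lambda>x. r \<odot>\<^bsub>M\<^esub> x) ` S = S \<or> (\<lambda>x. r \<odot>\<^bsub>M\<^esub> x) ` S = {\<zero>\<^bsub>M\<^esub>}"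
    and ne: "S \<noteq> {}"
    using S r submoduleE(2)
    unfolding graded_second_spectrum_def graded_second_def graded_submodule_def homogeneous_def
    by blast+
  have "(\<lambda>x. r \<odot>\<^bsub>M\<^esub> x) ` S \<noteq> S"
  proof
    assume "(\<lambda>x. r \<odot>\<^bsub>M\<^esub> x) ` S = S"
    then have "S = (\<lambda>x. (r [^]\<^bsub>R\<^esub> n) \<odot>\<^bsub>M\<^esub> x) ` S"
      using smult_pow_image_eq[OF rR SM] by simp
    also have "\<dots> = {\<zero>\<^bsub>M\<^esub>}" using n ne by (auto simp: ann_ring_def)
    finally show False using S0 by simp
  qed
  then have "(\<lambda>x. r \<odot>\<^bsub>M\<^esub> x) ` S = {\<zero>\<^bsub>M\<^esub>}" using sec by simp
  then show ?thesis using rR by (auto simp: ann_ring_def)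
qed

text \<open>The components of an element of the radical are homogeneous with a power in
  \<open>K\<close>, so each kills \<open>S\<close>, and then so does their sum.\<close>

lemma graded_radical_subset_ann_ring_second:
  assumes S: "S \<in> graded_second_spectrum G R Rg M Mg" and K: "K \<subseteq> ann_ring R M S"
  shows "graded_radical G R Rg K \<subseteq> ann_ring R M S"
proof
  fix a assume "a \<in> graded_radical G R Rg K"
  then obtain c where c: "c \<in> decompositions R (carrier G) Rg a"
    and pow: "\<forall>g\<in>carrier G. \<exists>n::nat. n > 0 \<and> c g [^]\<^bsub>R\<^esub> n \<in> K"
    unfolding graded_radical_def by blast
  have "c g \<in> ann_ring R M S" if g: "g \<in> carrier G" for g
  proof -
    have "c g \<in> Rg g" using c g unfolding decompositions_def by (auto simp: PiE_def Pi_def)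
    then show ?thesis
      using homogeneous_pow_in_ann_ring_second[OF S g] pow g K by blast
  qed
  then show "a \<in> ann_ring R M S"
    by (rule ann_ring_decompositions[OF graded_second_subset[OF S] c])
qed

text \<open>The Galois connection turns both sides into inclusions in \<open>ann_ring R M S\<close>,
  where \<open>K\<close> and its radical cannot be told apart.\<close>

lemma second_subset_ann_module_graded_radical_iff:
  assumes S: "S \<in> graded_second_spectrum G R Rg M Mg" and K: "K \<subseteq> carrier R"
    and rad: "K \<subseteq> graded_radical G R Rg K"
  shows "S \<subseteq> ann_module M (graded_radical G R Rg K) \<longleftrightarrow> S \<subseteq> ann_module M K"
proof -
  have radR: "graded_radical G R Rg K \<subseteq> carrier R" unfolding graded_radical_def by blast
  have "graded_radical G R Rg K \<subseteq> ann_ring R M S \<longleftrightarrow> K \<subseteq> ann_ring R M S"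
    using graded_radical_subset_ann_ring_second[OF S] rad subset_trans by metis
  then show ?thesis
    using subset_ann_ring_iff[OF radR graded_second_subset[OF S]]
      subset_ann_ring_iff[OF K graded_second_subset[OF S]] by simp
qed

section \<open>Comparison of the two socles\<close>

lemma zariski_socle_ann_module:
  assumes "K \<subseteq> carrier R"
  shows "graded_zariski_socle G R Rg M Mg (ann_module M K) = graded_socle G R Rg M Mg (ann_module M K)"
proof -
  have "second_variety G R Rg M Mg (ann_module M K)
      = {S \<in> graded_second_spectrum G R Rg M Mg. S \<subseteq> ann_module M K}"
    unfolding second_variety_def
    using ann_ring_subset_ann_ring_ann_module_iff[OF assms graded_second_subset] by blast
  then show ?thesis unfolding graded_zariski_socle_def graded_socle_def by simp
qed

text \<open>Assuming only that \<open>K\<close> lies in its graded radical lets the same lemma serve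
  both for \<open>I\<close> and for \<open>ann_ring R M N\<close>.\<close>

lemma socles_ann_module_graded_radical:
  assumes K: "K \<subseteq> carrier R" and rad: "K \<subseteq> graded_radical G R Rg K"
  shows "graded_zariski_socle G R Rg M Mg (ann_module M K)
      = graded_zariski_socle G R Rg M Mg (ann_module M (graded_radical G R Rg K))"
    and "graded_zariski_socle G R Rg M Mg (ann_module M (graded_radical G R Rg K))
      = graded_socle G R Rg M Mg (ann_module M K)"
    and "graded_socle G R Rg M Mg (ann_module M K)
      = graded_socle G R Rg M Mg (ann_module M (graded_radical G R Rg K))"
proof -
  have "{S \<in> graded_second_spectrum G R Rg M Mg. S \<subseteq> ann_module M (graded_radical G R Rg K)}
      = {S \<in> graded_second_spectrum G R Rg M Mg. S \<subseteq> ann_module M K}"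
    using second_subset_ann_module_graded_radical_iff[OF _ K rad] by blast
  then show soc: "graded_socle G R Rg M Mg (ann_module M K)
      = graded_socle G R Rg M Mg (ann_module M (graded_radical G R Rg K))"
    unfolding graded_socle_def by simp
  have "graded_radical G R Rg K \<subseteq> carrier R" unfolding graded_radical_def by blast
  then show "graded_zariski_socle G R Rg M Mg (ann_module M (graded_radical G R Rg K))
      = graded_socle G R Rg M Mg (ann_module M K)"
    by (rule trans[OF zariski_socle_ann_module soc[symmetric]])
  then show "graded_zariski_socle G R Rg M Mg (ann_module M K)
      = graded_zariski_socle G R Rg M Mg (ann_module M (graded_radical G R Rg K))"
    by (rule trans[OF zariski_socle_ann_module[OF K] sym])
qed

lemma zariski_socle_ann_module_ann_ring:
  assumes "N \<subseteq> carrier M"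
  shows "graded_zariski_socle G R Rg M Mg (ann_module M (ann_ring R M N))
      = graded_zariski_socle G R Rg M Mg N"
  unfolding graded_zariski_socle_def second_variety_def
  using ann_ring_ann_module_ann_ring[OF assms] by simp

lemma socle_subset_zariski_socle: "graded_socle G R Rg M Mg N \<subseteq> graded_zariski_socle G R Rg M Mg N"
  unfolding graded_socle_def graded_zariski_socle_def second_variety_def
  by (rule submodule_sum_mono) (auto simp: ann_ring_def)

text \<open>In a comultiplication module \<open>N\<close> is itself of the form
  \<open>ann_module M I\<close>, where the two socles agree.\<close>

lemma socle_eq_zariski_socle:
  assumes "comultiplication_graded_module G R Rg M Mg" and "graded_submodule G R M Mg N"
  shows "graded_socle G R Rg M Mg N = graded_zariski_socle G R Rg M Mg N"
proof -
  obtain I where I: "graded_ideal G R Rg I" "N = ann_module M I"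
    using assms unfolding comultiplication_graded_module_def by blast
  then have "I \<subseteq> carrier R"
    using additive_subgroup.a_subset ideal.axioms(1) unfolding graded_ideal_def by metis
  then show ?thesis using zariski_socle_ann_module I(2) by simp
qed

text \<open>Each \<open>S\<close> in the variety of \<open>N\<close> is a summand of the Zariski
  socle of \<open>N\<close>, hence lies in that of \<open>N'\<close>, which
  \<open>ann_ring R M N'\<close> kills.\<close>

lemma second_variety_subset_if_zariski_socle_subset:
  assumes "graded_zariski_socle G R Rg M Mg N \<subseteq> graded_zariski_socle G R Rg M Mg N'"
  shows "second_variety G R Rg M Mg N \<subseteq> second_variety G R Rg M Mg N'"
proof
  fix S assume S: "S \<in> second_variety G R Rg M Mg N"
  then have spec: "S \<in> graded_second_spectrum G R Rg M Mg"
    unfolding second_variety_def by simp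
  have "S \<subseteq> graded_zariski_socle G R Rg M Mg N'"
    using subset_submodule_sum[OF S graded_second_subset[OF spec]] assms
    unfolding graded_zariski_socle_def by blast
  \<comment> \<open>By definition of the variety, such an \<open>r\<close> kills every summand of
    the socle, hence the whole sum.\<close>
  moreover have "r \<in> ann_ring R M (graded_zariski_socle G R Rg M Mg N')"
    if "r \<in> ann_ring R M N'" for r
    unfolding graded_zariski_socle_def
    using that ann_ring_subset graded_second_subset
    by (intro ann_ring_kills_submodule_sum) (auto simp: second_variety_def)
  ultimately have "ann_ring R M N' \<subseteq> ann_ring R M S"
    unfolding ann_ring_def by blast
  then show "S \<in> second_variety G R Rg M Mg N'"
    using spec unfolding second_variety_def by simp
qed

end

theorem proposition3p6:
  fixes G :: "('g, 'k) monoid_scheme" and R :: "('r, 'l) ring_scheme" and Rg :: "'g \<Rightarrow> 'r set"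
    and M :: "('r, 'a, 'm) module_scheme" and Mg :: "'g \<Rightarrow> 'a set"
    and N N' :: "'a set" and I :: "'r set"
  assumes "graded_module G R Rg M Mg"
    and "graded_submodule G R M Mg N" and "graded_submodule G R M Mg N'"
    and "graded_ideal G R Rg I"
  shows
    "(graded_zariski_socle G R Rg M Mg (ann_module M I)
        = graded_zariski_socle G R Rg M Mg (ann_module M (graded_radical G R Rg I))
      \<and> graded_zariski_socle G R Rg M Mg (ann_module M (graded_radical G R Rg I))
        = graded_socle G R Rg M Mg (ann_module M I)
      \<and> graded_socle G R Rg M Mg (ann_module M I)
        = graded_socle G R Rg M Mg (ann_module M (graded_radical G R Rg I)))
     \<and> (graded_zariski_socle G R Rg M Mg N
        = graded_zariski_socle G R Rg M Mg (ann_module M (ann_ring R M N))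
      \<and> graded_zariski_socle G R Rg M Mg (ann_module M (ann_ring R M N))
        = graded_zariski_socle G R Rg M Mg (ann_module M (graded_radical G R Rg (ann_ring R M N)))
      \<and> graded_zariski_socle G R Rg M Mg (ann_module M (graded_radical G R Rg (ann_ring R M N)))
        = graded_socle G R Rg M Mg (ann_module M (ann_ring R M N))
      \<and> graded_socle G R Rg M Mg (ann_module M (ann_ring R M N))
        = graded_socle G R Rg M Mg (ann_module M (graded_radical G R Rg (ann_ring R M N))))
     \<and> (graded_socle G R Rg M Mg N \<subseteq> graded_zariski_socle G R Rg M Mg N
      \<and> (comultiplication_graded_module G R Rg M Mg \<longrightarrow>
           graded_socle G R Rg M Mg N = graded_zariski_socle G R Rg M Mg N))
     \<and> (second_variety G R Rg M Mg N \<subseteq> second_variety G R Rg M Mg N' \<longrightarrow>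
       graded_zariski_socle G R Rg M Mg N \<subseteq> graded_zariski_socle G R Rg M Mg N')
     \<and> (second_variety G R Rg M Mg N = second_variety G R Rg M Mg N' \<longleftrightarrow>
       graded_zariski_socle G R Rg M Mg N = graded_zariski_socle G R Rg M Mg N')"
proof -
  interpret graded_module G R Rg M Mg by fact
  have I: "I \<subseteq> carrier R"
    using assms(4) additive_subgroup.a_subset ideal.axioms(1) unfolding graded_ideal_def by metis
  note N = graded_submodule_subset[OF assms(2)]
  note 1 = socles_ann_module_graded_radical[OF I graded_ideal_subset_graded_radical[OF assms(4)]]
  note 2 = zariski_socle_ann_module_ann_ring[OF N, symmetric]
    socles_ann_module_graded_radical[OF ann_ring_subset ann_ring_subset_graded_radical[OF assms(2)]]
  note 3 = socle_subset_zariski_socle[of N] socle_eq_zariski_socle[OF _ assms(2)]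
  have 4: "second_variety G R Rg M Mg N \<subseteq> second_variety G R Rg M Mg N' \<Longrightarrow>
      graded_zariski_socle G R Rg M Mg N \<subseteq> graded_zariski_socle G R Rg M Mg N'"
    unfolding graded_zariski_socle_def by (rule submodule_sum_mono)
  \<comment> \<open>The forward direction is congruence, as the socle is a function of the variety;
    the converse applies the recovery lemma to both inclusions.\<close>
  have 5: "second_variety G R Rg M Mg N = second_variety G R Rg M Mg N' \<longleftrightarrow>
      graded_zariski_socle G R Rg M Mg N = graded_zariski_socle G R Rg M Mg N'"
    using second_variety_subset_if_zariski_socle_subset
    unfolding graded_zariski_socle_def by (metis subset_antisym subset_refl)
  show ?thesis
    by (intro conjI impI 1 2 3 4 5)
qed

end
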